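(* Suppose that $F : \mathsf C \to \mathsf D$ is a separable functor which preserves epimorphisms. Let $M$ be an object of $\mathsf C$ such that $F(M)$ is quotient semisimple in $\mathsf D$. Then $M$ is quotient semisimple in $\mathsf C$.
   Context: Functors are covariant. A functor $F:\mathsf C\to\mathsf D$ is separable if for all objects $M,N$ of $\mathsf C$ there is a function $R_{M,N}:\mathrm{Hom}_{\mathsf D}(F(M),F(N))\to\mathrm{Hom}_{\mathsf C}(M,N)$ such that (SF1) $R_{M,N}(F(h))=h$ for all $h:M\to N$ in $\mathsf C$; and (SF2) for all $h:M\to M'$, $g:N\to N'$ in $\mathsf C$ and $h':F(M)\to F(N)$, $g':F(M')\to F(N')$ in $\mathsf D$, if $F(g)h'=g'F(h)$ then $g\,R_{M,N}(h')=R_{M',N'}(g')\,h$. An object $M$ of a category is quotient semisimple if every epimorphism $e:M\to P$ has a section, i.e. a morphism $s:P\to M$ with $es=\mathrm{id}_P$. *)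

theory Defs
  imports "HOL-Library.FuncSet"
begin

text \<open>
  A category is presented by a carrier of objects and a carrier of arrows. Domain and codomain are
  part of an arrow, so hom-sets are disjoint. \<open>g \<cdot>\<^bsub>C\<^esub> f\<close> is ``\<open>g\<close> after \<open>f\<close>'' and is constrained
  only when \<open>Cod C f = Dom C g\<close>; nothing is required outside the carriers.
\<close>

record ('o, 'm) cat =
  Obj :: "'o set"
  Arr :: "'m set"
  Dom :: "'m \<Rightarrow> 'o"
  Cod :: "'m \<Rightarrow> 'o"
  Id  :: "'o \<Rightarrow> 'm"
  Comp :: "'m \<Rightarrow> 'm \<Rightarrow> 'm"  (infixl "\<cdot>\<index>" 70)

definition Hom :: "('o, 'm, 'x) cat_scheme \<Rightarrow> 'o \<Rightarrow> 'o \<Rightarrow> 'm set" where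
  "Hom C A B = {f \<in> Arr C. Dom C f = A \<and> Cod C f = B}"

locale category =
  fixes C :: "('o, 'm, 'x) cat_scheme" (structure)
  assumes Dom_in_Obj: "f \<in> Arr C \<Longrightarrow> Dom C f \<in> Obj C"
    and Cod_in_Obj: "f \<in> Arr C \<Longrightarrow> Cod C f \<in> Obj C"
    and Id_in_Hom: "A \<in> Obj C \<Longrightarrow> Id C A \<in> Hom C A A"
    and Comp_in_Hom: "f \<in> Hom C A B \<Longrightarrow> g \<in> Hom C B B' \<Longrightarrow> g \<cdot> f \<in> Hom C A B'"
    and Comp_assoc: "f \<in> Hom C A B \<Longrightarrow> g \<in> Hom C B B' \<Longrightarrow> h \<in> Hom C B' B''
      \<Longrightarrow> (h \<cdot> g) \<cdot> f = h \<cdot> (g \<cdot> f)"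
    and Comp_Id: "f \<in> Hom C A B \<Longrightarrow> f \<cdot> Id C A = f"
    and Id_Comp: "f \<in> Hom C A B \<Longrightarrow> Id C B \<cdot> f = f"

locale covariant_functor = C: category C + D: category D
  for C :: "('o1, 'm1, 'x1) cat_scheme" and D :: "('o2, 'm2, 'x2) cat_scheme" +
  fixes Fo :: "'o1 \<Rightarrow> 'o2" and Fa :: "'m1 \<Rightarrow> 'm2"
  assumes Fo_in_Obj: "A \<in> Obj C \<Longrightarrow> Fo A \<in> Obj D"
    and Fa_in_Hom: "f \<in> Hom C A B \<Longrightarrow> Fa f \<in> Hom D (Fo A) (Fo B)"
    and Fa_Id: "A \<in> Obj C \<Longrightarrow> Fa (Id C A) = Id D (Fo A)"
    and Fa_Comp: "f \<in> Hom C A B \<Longrightarrow> g \<in> Hom C B B' \<Longrightarrow> Fa (g \<cdot>\<^bsub>C\<^esub> f) = Fa g \<cdot>\<^bsub>D\<^esub> Fa f"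

definition separable_functor ::
  "('o1, 'm1, 'x1) cat_scheme \<Rightarrow> ('o2, 'm2, 'x2) cat_scheme \<Rightarrow>
    ('o1 \<Rightarrow> 'o2) \<Rightarrow> ('m1 \<Rightarrow> 'm2) \<Rightarrow> bool" where
  "separable_functor C D Fo Fa \<longleftrightarrow>
    covariant_functor C D Fo Fa \<and>
    (\<exists>R :: 'o1 \<Rightarrow> 'o1 \<Rightarrow> 'm2 \<Rightarrow> 'm1.
      (\<forall>M \<in> Obj C. \<forall>N \<in> Obj C. R M N \<in> Hom D (Fo M) (Fo N) \<rightarrow> Hom C M N) \<and>
      (\<forall>M \<in> Obj C. \<forall>N \<in> Obj C. \<forall>h \<in> Hom C M N. R M N (Fa h) = h) \<and>
      (\<forall>M \<in> Obj C. \<forall>M' \<in> Obj C. \<forall>N \<in> Obj C. \<forall>N' \<in> Obj C.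
        \<forall>h \<in> Hom C M M'. \<forall>g \<in> Hom C N N'.
        \<forall>h' \<in> Hom D (Fo M) (Fo N). \<forall>g' \<in> Hom D (Fo M') (Fo N').
          Fa g \<cdot>\<^bsub>D\<^esub> h' = g' \<cdot>\<^bsub>D\<^esub> Fa h \<longrightarrow> g \<cdot>\<^bsub>C\<^esub> R M N h' = R M' N' g' \<cdot>\<^bsub>C\<^esub> h))"

definition epimorphism :: "('o, 'm, 'x) cat_scheme \<Rightarrow> 'm \<Rightarrow> bool" where
  "epimorphism C e \<longleftrightarrow> e \<in> Arr C \<and>
    (\<forall>X \<in> Obj C. \<forall>g \<in> Hom C (Cod C e) X. \<forall>h \<in> Hom C (Cod C e) X.
      g \<cdot>\<^bsub>C\<^esub> e = h \<cdot>\<^bsub>C\<^esub> e \<longrightarrow> g = h)"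

definition preserves_epimorphisms ::
  "('o1, 'm1, 'x1) cat_scheme \<Rightarrow> ('o2, 'm2, 'x2) cat_scheme \<Rightarrow> ('m1 \<Rightarrow> 'm2) \<Rightarrow> bool" where
  "preserves_epimorphisms C D Fa \<longleftrightarrow> (\<forall>e. epimorphism C e \<longrightarrow> epimorphism D (Fa e))"

definition quotient_semisimple :: "('o, 'm, 'x) cat_scheme \<Rightarrow> 'o \<Rightarrow> bool" where
  "quotient_semisimple C M \<longleftrightarrow> M \<in> Obj C \<and>
    (\<forall>P \<in> Obj C. \<forall>e \<in> Hom C M P. epimorphism C e \<longrightarrow> (\<exists>s \<in> Hom C P M. e \<cdot>\<^bsub>C\<^esub> s = Id C P))"

end

theory Submission
  imports Defs
begin

text \<open>
  Separability lets a splitting be pulled back along the functor. If \<open>e : M \<rightarrow> P\<close> is an epimorphism,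
  so is its image, which therefore has a section \<open>t\<close> by quotient semisimplicity of the image of
  \<open>M\<close>. The retraction of hom-sets supplied by separability then turns \<open>t\<close> into a section of \<open>e\<close>
  (\<open>separable_functor_reflects_sections\<close>).
\<close>

text \<open>
  The section is the retract \<open>R P M t\<close>: naturality of \<open>R\<close> carries the equation \<open>Fa e \<cdot> t = Id\<close>
  over to \<open>C\<close>, because \<open>R\<close> sends the identity of \<open>Fo P\<close>, which is \<open>Fa\<close> of an identity, back to
  the identity of \<open>P\<close>.
\<close>

lemma separable_functor_reflects_sections:
  assumes sep: "separable_functor C D Fo Fa"
    and M: "M \<in> Obj C" and P: "P \<in> Obj C" and e: "e \<in> Hom C M P"
    and t: "t \<in> Hom D (Fo P) (Fo M)" and split: "Fa e \<cdot>\<^bsub>D\<^esub> t = Id D (Fo P)"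
  shows "\<exists>s \<in> Hom C P M. e \<cdot>\<^bsub>C\<^esub> s = Id C P"
proof -
  interpret covariant_functor C D Fo Fa
    using sep by (simp add: separable_functor_def)
  obtain R where R_Hom: "\<forall>M \<in> Obj C. \<forall>N \<in> Obj C. R M N \<in> Hom D (Fo M) (Fo N) \<rightarrow> Hom C M N"
    and R_Fa: "\<forall>M \<in> Obj C. \<forall>N \<in> Obj C. \<forall>h \<in> Hom C M N. R M N (Fa h) = h"
    and R_natural: "\<forall>M \<in> Obj C. \<forall>M' \<in> Obj C. \<forall>N \<in> Obj C. \<forall>N' \<in> Obj C.
        \<forall>h \<in> Hom C M M'. \<forall>g \<in> Hom C N N'.
        \<forall>h' \<in> Hom D (Fo M) (Fo N). \<forall>g' \<in> Hom D (Fo M') (Fo N').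
          Fa g \<cdot>\<^bsub>D\<^esub> h' = g' \<cdot>\<^bsub>D\<^esub> Fa h \<longrightarrow> g \<cdot>\<^bsub>C\<^esub> R M N h' = R M' N' g' \<cdot>\<^bsub>C\<^esub> h"
    using sep unfolding separable_functor_def by (elim conjE exE)
  have IdP: "Id C P \<in> Hom C P P"
    by (rule C.Id_in_Hom[OF P])
  have IdFP: "Id D (Fo P) \<in> Hom D (Fo P) (Fo P)"
    by (rule D.Id_in_Hom[OF Fo_in_Obj[OF P]])
  \<comment> \<open>The splitting is a commutative square whose other two sides are identities.\<close>
  have "Fa e \<cdot>\<^bsub>D\<^esub> t = Id D (Fo P) \<cdot>\<^bsub>D\<^esub> Fa (Id C P)"
    using split D.Comp_Id[OF IdFP] by (simp add: Fa_Id[OF P])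
  then have "e \<cdot>\<^bsub>C\<^esub> R P M t = R P P (Id D (Fo P)) \<cdot>\<^bsub>C\<^esub> Id C P"
    by (rule R_natural[rule_format, OF P P M P IdP e t IdFP])
  also have "R P P (Id D (Fo P)) = Id C P"
    using R_Fa[rule_format, OF P P IdP] by (simp add: Fa_Id[OF P])
  also have "Id C P \<cdot>\<^bsub>C\<^esub> Id C P = Id C P"
    by (rule C.Comp_Id[OF IdP])
  finally show ?thesis
    using funcset_mem[OF R_Hom[rule_format, OF P M] t] by blast
qed

theorem proposition22:
  fixes C :: "('o1, 'm1) cat" and D :: "('o2, 'm2) cat"
    and Fo :: "'o1 \<Rightarrow> 'o2" and Fa :: "'m1 \<Rightarrow> 'm2" and M :: 'o1
  assumes "category C" and "category D"
    and "covariant_functor C D Fo Fa"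
    and "separable_functor C D Fo Fa"
    and "preserves_epimorphisms C D Fa"
    and "M \<in> Obj C"
    and "quotient_semisimple D (Fo M)"
  shows "quotient_semisimple C M"
  unfolding quotient_semisimple_def
proof (intro conjI ballI impI)
  show "M \<in> Obj C" by fact
next
  interpret covariant_functor C D Fo Fa by fact
  fix P e
  assume P: "P \<in> Obj C" and e: "e \<in> Hom C M P" and epi: "epimorphism C e"
  have "epimorphism D (Fa e)"
    using assms(5) epi unfolding preserves_epimorphisms_def by blast
  then obtain t where "t \<in> Hom D (Fo P) (Fo M)" "Fa e \<cdot>\<^bsub>D\<^esub> t = Id D (Fo P)"
    using assms(7) Fo_in_Obj[OF P] Fa_in_Hom[OF e] unfolding quotient_semisimple_def by blast
  then show "\<exists>s \<in> Hom C P M. e \<cdot>\<^bsub>C\<^esub> s = Id C P"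
    by (rule separable_functor_reflects_sections[OF assms(4,6) P e])
qed

end
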